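(* Let $\Gamma$ be a countable group and let $(X,T,\Gamma)$ be an aperiodic minimal Cantor system. Then there exists a minimal Cantor system $(Y,S,\mathbb{Z})$ such that $\mathrm{Aut}(T,\Gamma)$ is isomorphic to a subgroup of $\mathrm{Aut}(S,\mathbb{Z})$.
   Context: A Cantor set is a nonempty compact metrizable totally disconnected space without isolated points. A Cantor system $(X,T,\Gamma)$ is a continuous action $T:\Gamma\times X\to X$ of a countable (discrete) group $\Gamma$ on a Cantor set $X$; write $T^{\gamma}:X\to X$ for the homeomorphism $x\mapsto T(\gamma,x)$. The system is aperiodic if the action is free, i.e. $T^{\gamma}(x)=x$ for some $x\in X$ implies $\gamma=1_\Gamma$. It is minimal if for every $x\in X$ the orbit $\{T^{\gamma}(x):\gamma\in\Gamma\}$ is dense in $X$. $\mathrm{Aut}(T,\Gamma)$ (the centralizer, or group of automorphisms, of the system) is the group under composition of all homeomorphisms $h:X\to X$ such that $h\circ T^{\gamma}=T^{\gamma}\circ h$ for every $\gamma\in\Gamma$. Subgroups and isomorphisms are meant as abstract groups. *)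

theory Defs
  imports "HOL-Analysis.Analysis" "HOL-Algebra.Group_Action" "HOL-Algebra.Elementary_Groups"
begin

definition totally_disconnected_space :: "'a topology \<Rightarrow> bool"
  where "totally_disconnected_space X \<longleftrightarrow> (\<forall>C. connectedin X C \<longrightarrow> (\<exists>x. C \<subseteq> {x}))"

definition cantor_set :: "'a topology \<Rightarrow> bool"
  where "cantor_set X \<longleftrightarrow>
    topspace X \<noteq> {} \<and> compact_space X \<and> metrizable_space X \<and>
    totally_disconnected_space X \<and> (\<forall>x\<in>topspace X. \<not> openin X {x})"

text \<open>
  The library locale \<open>group_action\<close> represents each \<open>T g\<close> by a bijection of
  \<^term>\<open>topspace X\<close> that is extensional (equal to \<^const>\<open>undefined\<close> outside
  \<^term>\<open>topspace X\<close>). This only fixes junk values.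
\<close>

locale cantor_system = group_action G "topspace X" T
  for G (structure) and X :: "'a topology" and T +
  assumes countable_group: "countable (carrier G)"
    and cantor_set: "cantor_set X"
    and continuous_action:
      "continuous_map (prod_topology (discrete_topology (carrier G)) X) X (\<lambda>(g, x). T g x)"

locale aperiodic_cantor_system = cantor_system +
  assumes aperiodic: "\<lbrakk>g \<in> carrier G; x \<in> topspace X; T g x = x\<rbrakk> \<Longrightarrow> g = \<one>"

locale minimal_cantor_system = cantor_system +
  assumes minimal: "x \<in> topspace X \<Longrightarrow> X closure_of (orbit G T x) = topspace X"

text \<open>
  Automorphisms are taken extensional, so that two of them are equal as HOL functions
  exactly when they agree on \<^term>\<open>topspace X\<close>; multiplication is composition on
  \<^term>\<open>topspace X\<close>, inherited from \<^const>\<open>BijGroup\<close>.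
\<close>

definition automorphisms ::
    "('g, 'm) monoid_scheme \<Rightarrow> 'a topology \<Rightarrow> ('g \<Rightarrow> 'a \<Rightarrow> 'a) \<Rightarrow> ('a \<Rightarrow> 'a) set"
  where "automorphisms G X T =
    {h \<in> extensional (topspace X). homeomorphic_map X X h \<and>
       (\<forall>g\<in>carrier G. \<forall>x\<in>topspace X. h (T g x) = T g (h x))}"

definition Aut_group ::
    "('g, 'm) monoid_scheme \<Rightarrow> 'a topology \<Rightarrow> ('g \<Rightarrow> 'a \<Rightarrow> 'a) \<Rightarrow> ('a \<Rightarrow> 'a) monoid"
  where "Aut_group G X T = (BijGroup (topspace X))\<lparr>carrier := automorphisms G X T\<rparr>"

lemma automorphisms_subset_Bij: "automorphisms G X T \<subseteq> Bij (topspace X)"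
  by (auto simp: automorphisms_def Bij_def bij_betw_def homeomorphic_imp_injective_map
      dest: homeomorphic_imp_surjective_map)

lemma (in cantor_system) subgroup_automorphisms:
  "subgroup (automorphisms G X T) (BijGroup (topspace X))"
proof -
  let ?E = "topspace X"
  have T_in: "T g x \<in> ?E" if "g \<in> carrier G" "x \<in> ?E" for g x
    using element_image[OF that] by simp
  interpret B: group "BijGroup ?E"
    by (rule group_BijGroup)
  show ?thesis
  proof (rule B.subgroupI)
    show "automorphisms G X T \<subseteq> carrier (BijGroup ?E)"
      using automorphisms_subset_Bij by (simp add: BijGroup_def)
  next
    have "homeomorphic_map X X (restrict id ?E)"
      by (rule homeomorphic_map_eq[of X X id]) auto
    then have "restrict id ?E \<in> automorphisms G X T"
      by (auto simp: automorphisms_def T_in)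
    then show "automorphisms G X T \<noteq> {}"
      by blast
  next
    fix h assume h: "h \<in> automorphisms G X T"
    then have hB: "h \<in> Bij ?E"
      using automorphisms_subset_Bij by blast
    then have bij: "bij_betw h ?E ?E"
      by (simp add: Bij_def)
    have hom: "homeomorphic_map X X h"
      and eqv: "\<And>g x. \<lbrakk>g \<in> carrier G; x \<in> ?E\<rbrakk> \<Longrightarrow> h (T g x) = T g (h x)"
      using h by (auto simp: automorphisms_def)
    let ?k = "restrict (inv_into ?E h) ?E"
    obtain f where f: "homeomorphic_maps X X h f"
      using hom by (auto simp: homeomorphic_map_maps)
    have fk: "f x = ?k x" if "x \<in> ?E" for x
      using f that bij unfolding homeomorphic_maps_def continuous_map_def
      by (simp add: Pi_iff) (metis bij_betw_inv_into_left)
    have "homeomorphic_map X X f"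
      using f homeomorphic_maps_map by blast
    then have k_hom: "homeomorphic_map X X ?k"
      using fk homeomorphic_map_eq by blast
    have "?k (T g x) = T g (?k x)" if gx: "g \<in> carrier G" "x \<in> ?E" for g x
    proof -
      let ?y = "inv_into ?E h x"
      have y: "?y \<in> ?E" "h ?y = x"
        using bij gx by (auto simp: bij_betw_def f_inv_into_f inv_into_into)
      then have "h (T g ?y) = T g x"
        using eqv gx by simp
      then have "inv_into ?E h (T g x) = T g ?y"
        using bij_betw_inv_into_left[OF bij T_in[OF gx(1) y(1)]] by simp
      then show ?thesis
        using gx T_in by simp
    qed
    with k_hom have "?k \<in> automorphisms G X T"
      by (simp add: automorphisms_def)
    then show "inv\<^bsub>BijGroup ?E\<^esub> h \<in> automorphisms G X T"
      using inv_BijGroup[OF hB] by (simp add: restrict_def)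
  next
    fix h k assume h: "h \<in> automorphisms G X T" and k: "k \<in> automorphisms G X T"
    have hk: "h \<in> Bij ?E" "k \<in> Bij ?E"
      using h k automorphisms_subset_Bij by blast+
    have k_in: "k x \<in> ?E" if "x \<in> ?E" for x
      using hk(2) that by (auto simp: Bij_def bij_betw_def)
    have "homeomorphic_map X X (h \<circ> k)"
      using h k by (auto simp: automorphisms_def intro: homeomorphic_map_compose)
    then have "homeomorphic_map X X (compose ?E h k)"
      by (rule homeomorphic_map_eq) (simp add: compose_def)
    then have "compose ?E h k \<in> automorphisms G X T"
      using h k by (auto simp: automorphisms_def compose_def T_in k_in)
    then show "h \<otimes>\<^bsub>BijGroup ?E\<^esub> k \<in> automorphisms G X T"
      using hk by (simp add: BijGroup_def)
  qed
qed

lemma (in cantor_system) group_Aut_group: "group (Aut_group G X T)"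
  unfolding Aut_group_def
  by (rule subgroup.subgroup_is_group[OF subgroup_automorphisms group_BijGroup])

end

theory Submission
  imports Defs
begin

text \<open>
  A sequence \<open>(v\<^sub>i)\<close> of group elements, indexed by the integers, turns each point \<open>x\<close> of \<open>X\<close>
  into a path: the two-sided sequence \<open>i \<mapsto> T\<^bsup>v\<^sub>i\<^esup> x\<close>. Let \<open>Y\<close> be the closure, in the space of
  all two-sided sequences over \<open>X\<close>, of the set of all translates of paths, and let the integers act
  on \<open>Y\<close> by translation. An automorphism \<open>h\<close> of the original system maps the path of \<open>x\<close> to the path
  of \<open>h x\<close> when it is applied to every coordinate, since it commutes with every \<open>T\<^bsup>g\<^esup>\<close>. Hence it acts
  on \<open>Y\<close>, this action commutes with translation, and it determines \<open>h\<close> because every point of \<open>X\<close>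
  is the zeroth entry of its path. So \<open>Aut(T, G)\<close> embeds in the automorphism group of \<open>Y\<close> for any
  choice of \<open>v\<close> with \<open>v\<^sub>0 = 1\<close>. The point of the construction is a \<open>v\<close> for which \<open>Y\<close> is minimal.

  It suffices that, for all \<open>x\<close> and \<open>x'\<close>, the translates of the path of \<open>x\<close> that are close to the
  path of \<open>x'\<close> on a given window occur with gaps bounded independently of \<open>x\<close>: this bound passes to
  the closure. Such a \<open>v\<close> exists for every countable group, independently of the action.
  Let \<open>e\<close> enumerate \<open>G\<close> so that each element occurs infinitely often, and let \<open>v\<^sub>i\<close> be
  the product, over the base-4 digits of \<open>i\<close> from the lowest one, of \<open>e n\<close> if the \<open>n\<close>-th digit is 1 or 2
  and of 1 if it is 0 or 3. Then, near the time \<open>4\<^sup>m k + 2 \<cdot> 4\<^sup>j\<close> with \<open>j < m\<close>,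
  the sequence repeats its central window of radius \<open>4\<^sup>j\<close>, multiplied on the right by
  \<open>e j\<close> times the value at time \<open>4\<^sup>m k\<close> (\<open>digit_product_window\<close>). Among the \<open>e j\<close> with \<open>j < m\<close> there are, for
  large \<open>m\<close>, all members of a given finite subset of \<open>G\<close>, even with \<open>j\<close> as large as desired.
  By minimality and compactness, finitely many group elements suffice to carry every point of \<open>X\<close>
  into a given neighbourhood of \<open>x'\<close>. So in each block of length \<open>4\<^sup>m\<close> some \<open>j\<close> brings the path of \<open>x\<close>
  close to the path of \<open>x'\<close> (\<open>path_returns\<close>).

  Finally, \<open>Y\<close> is compact and metrizable, so its points can be coded by sequences of truth values
  and the topology carried along.
\<close>

section \<open>Digit products\<close>

context group
begin

text \<open>
  With \<open>j = \<Sum>\<^sub>n d\<^sub>n 4\<^sup>n\<close> this is the product \<open>f\<^sub>0(d\<^sub>0) f\<^sub>1(d\<^sub>1) \<dots>\<close>, where \<open>f\<^sub>n\<close> takes the value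
  \<open>e n\<close> at the digits 1 and 2 and the value 1 at 0 and 3. A negative number has infinitely many leading
  digits 3, and \<open>-1\<close> has no others; as \<open>f\<^sub>n(3) = 1\<close>, the product is finite there as well.
\<close>

function digit_product :: "(nat \<Rightarrow> 'a) \<Rightarrow> int \<Rightarrow> 'a"
  where "digit_product e j =
    (if j = 0 \<or> j = -1 then \<one>
     else (if j mod 4 \<in> {1, 2} then e 0 else \<one>) \<otimes> digit_product (\<lambda>n. e (Suc n)) (j div 4))"
  by pat_completeness auto
termination
  by (relation "Wellfounded.measure (\<lambda>(e, j). nat \<bar>j\<bar>)") auto

declare digit_product.simps [simp del]

lemma digit_product_0 [simp]: "digit_product e 0 = \<one>"
  and digit_product_minus_1 [simp]: "digit_product e (-1) = \<one>"
  by (simp_all add: digit_product.simps)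

lemma digit_product_closed [simp]:
  "range e \<subseteq> carrier G \<Longrightarrow> digit_product e j \<in> carrier G"
proof (induction e j rule: digit_product.induct)
  case (1 e j)
  then show ?case
    by (subst digit_product.simps) (auto simp: image_subset_iff)
qed

lemma digit_product_rec:
  assumes "range e \<subseteq> carrier G"
  shows "digit_product e j =
    (if j mod 4 \<in> {1, 2} then e 0 else \<one>) \<otimes> digit_product (\<lambda>n. e (Suc n)) (j div 4)"
proof (cases "j = 0 \<or> j = -1")
  case True
  then show ?thesis by auto
next
  case False
  then show ?thesis
    by (subst digit_product.simps) simp
qed

text \<open>
  The number \<open>4\<^sup>m k + i\<close> has the digits of \<open>i\<close> in its \<open>m\<close> lowest places and those of \<open>k\<close> above them.
\<close>

lemma digit_product_block:
  assumes "range e \<subseteq> carrier G" "0 \<le> i" "i < 4 ^ m"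
  shows "digit_product e (4 ^ m * k + i) = digit_product e i \<otimes> digit_product (\<lambda>n. e (n + m)) k"
  using assms
proof (induction m arbitrary: e i)
  case 0
  then have "i = 0"
    by simp
  then show ?case
    using digit_product_closed[OF 0(1), of k] by simp
next
  case (Suc m)
  let ?e = "\<lambda>n. e (Suc n)"
  let ?d = "if i mod 4 \<in> {1, 2} then e 0 else \<one>"
  have e: "range ?e \<subseteq> carrier G" "range (\<lambda>n. e (n + Suc m)) \<subseteq> carrier G" "?d \<in> carrier G"
    using Suc.prems(1) by auto
  have eq: "4 ^ Suc m * k + i = 4 * (4 ^ m * k) + i"
    by simp
  have "digit_product e (4 ^ Suc m * k + i) = ?d \<otimes> digit_product ?e (4 ^ m * k + i div 4)"
    unfolding eq digit_product_rec[OF Suc.prems(1), of "4 * (4 ^ m * k) + i"] by simp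
  also have "digit_product ?e (4 ^ m * k + i div 4) =
      digit_product ?e (i div 4) \<otimes> digit_product (\<lambda>n. e (n + Suc m)) k"
    using Suc.IH[OF e(1), of "i div 4"] Suc.prems(2,3) by simp
  also have "?d \<otimes> (digit_product ?e (i div 4) \<otimes> digit_product (\<lambda>n. e (n + Suc m)) k) =
      (?d \<otimes> digit_product ?e (i div 4)) \<otimes> digit_product (\<lambda>n. e (n + Suc m)) k"
    using e by (simp only: m_assoc digit_product_closed)
  also have "?d \<otimes> digit_product ?e (i div 4) = digit_product e i"
    by (rule digit_product_rec[OF Suc.prems(1), symmetric])
  finally show ?case .
qed

text \<open>
  Above its \<open>m\<close> lowest places \<open>i\<close> has only digits 3, and \<open>4\<^sup>m + i\<close> has only digits 0; neither contributes.
\<close>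

lemma digit_product_negative:
  assumes "range e \<subseteq> carrier G" "- (4 ^ m) \<le> i" "i < 0"
  shows "digit_product e (4 ^ m + i) = digit_product e i"
proof -
  have "range (\<lambda>n. e (n + m)) \<subseteq> carrier G"
    using assms(1) by auto
  then show ?thesis
    using digit_product_block[OF assms(1), of "4 ^ m + i" m "-1"] assms by simp
qed

text \<open>
  This is why each \<open>f\<^sub>n\<close> takes each of its values at two consecutive digits. For \<open>t \<ge> 0\<close> the number
  \<open>4\<^sup>m k + 2 \<cdot> 4\<^sup>j + t\<close> has the digit 2 in place \<open>j\<close>, for \<open>t < 0\<close> it has the digit 1 there, and \<open>e j\<close> is
  contributed in both cases. So the window around this time is, on both sides of its centre, the window
  around 0 multiplied on the right by one and the same element.
\<close>

lemma digit_product_window: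
  assumes e: "range e \<subseteq> carrier G" and "j < m" and t: "- (4 ^ j) \<le> t" "t < 4 ^ j"
  shows "digit_product e (4 ^ m * k + 2 * 4 ^ j + t) =
    digit_product e t \<otimes> (e j \<otimes> digit_product e (4 ^ m * k))"
proof -
  define c where "c = 4 ^ (m - Suc j) * k"
  have m: "4 ^ m * k = 4 ^ j * (4 * c)"
    using \<open>j < m\<close> by (simp add: c_def flip: power_add power_Suc mult.assoc)
  let ?e = "\<lambda>n. e (n + j)"
  have e': "range ?e \<subseteq> carrier G" "range (\<lambda>n. e (Suc (n + j))) \<subseteq> carrier G"
    using e by auto
  define r where "r = digit_product (\<lambda>n. e (Suc (n + j))) c"
  have digit: "digit_product ?e (4 * c) = r" "digit_product ?e (4 * c + 1) = e j \<otimes> r"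
      "digit_product ?e (4 * c + 2) = e j \<otimes> r"
    using e' by (simp_all add: digit_product_rec[OF e'(1)] r_def)
  have "digit_product e (4 ^ m * k) = r"
    using digit_product_block[OF e, of 0 j "4 * c"] digit e' m by (simp add: r_def)
  moreover have "digit_product e (4 ^ m * k + 2 * 4 ^ j + t) = digit_product e t \<otimes> (e j \<otimes> r)"
  proof (cases "0 \<le> t")
    case True
    have "4 ^ m * k + 2 * 4 ^ j + t = 4 ^ j * (4 * c + 2) + t"
      unfolding m by (simp add: algebra_simps)
    then show ?thesis
      using digit_product_block[OF e True t(2), of "4 * c + 2"] by (simp only: digit)
  next
    case False
    have arg: "4 ^ m * k + 2 * 4 ^ j + t = 4 ^ j * (4 * c + 1) + (4 ^ j + t)"
      unfolding m by (simp add: algebra_simps)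
    have "digit_product e (4 ^ j + t) = digit_product e t"
      using digit_product_negative[OF e t(1)] False by simp
    then show ?thesis
      using digit_product_block[OF e, of "4 ^ j + t" j "4 * c + 1"] t(1) False
      unfolding arg digit by simp
  qed
  ultimately show ?thesis
    by simp
qed

end

section \<open>Cantor sets inside \<open>nat \<Rightarrow> bool\<close>\<close>

text \<open>
  A compact metric space has a countable set \<open>A\<close> that is \<open>1/n\<close>-dense for all \<open>n\<close>. A point \<open>x\<close> is
  determined by the pairs \<open>(a, n)\<close> with \<open>a \<in> A\<close> for which \<open>x\<close> lies in the \<open>1/n\<close>-ball around \<open>a\<close>.
\<close>

lemma compact_metrizable_inj_into_nat_bool:
  assumes "compact_space X" "metrizable_space X"
  shows "\<exists>q :: 'a \<Rightarrow> nat \<Rightarrow> bool. inj_on q (topspace X)"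
proof -
  obtain M d where "Metric_space M d" and X: "X = Metric_space.mtopology M d"
    using assms(2) by (auto simp: metrizable_space_def)
  then interpret Metric_space M d by simp
  have "mtotally_bounded M"
    using assms(1) X compact_space_eq_mcomplete_mtotally_bounded by simp
  then have "\<exists>K. finite K \<and> K \<subseteq> M \<and> M \<subseteq> (\<Union>x\<in>K. mball x (1 / Suc n))" for n
    unfolding mtotally_bounded_def by simp
  then obtain K where K: "\<And>n. finite (K n)" "\<And>n. K n \<subseteq> M" "\<And>n. M \<subseteq> (\<Union>x\<in>K n. mball x (1 / Suc n))"
    by metis
  define A where "A = (\<Union>n. K n)"
  have A: "countable A"
    unfolding A_def using K(1) by (simp add: countable_finite)
  define q where
    "q = (\<lambda>x m. d (from_nat_into A (fst (prod_decode m))) x < 1 / Suc (snd (prod_decode m)))"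
  have "x = y" if x: "x \<in> M" and y: "y \<in> M" and eq: "q x = q y" for x y
  proof (rule ccontr)
    assume "x \<noteq> y"
    then have "0 < d x y / 2"
      using x y by simp
    then obtain n where n: "1 / Suc n < d x y / 2"
      using nat_approx_posE by blast
    obtain a where a: "a \<in> K n" "d a x < 1 / Suc n"
      using K(3)[of n] x by auto
    then obtain i where i: "from_nat_into A i = a"
      using from_nat_into_surj[OF A, of a] by (auto simp: A_def)
    have "d a y < 1 / Suc n"
      using fun_cong[OF eq, of "prod_encode (i, n)"] a(2) i by (simp add: q_def)
    moreover have "d x y \<le> d a x + d a y"
      using triangle[of x a y] commute[of x a] a(1) K(2) x y by auto
    ultimately show False
      using n a(2) by linarith
  qed
  then show ?thesis
    by (auto simp: X inj_on_def)
qed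

text \<open>
  \<open>Z\<close> carries the topology transported along an injection of the points, in general not the
  product topology.
\<close>

lemma homeomorphic_copy_on_nat_bool:
  assumes "compact_space X" "metrizable_space X"
  shows "\<exists>(Z :: (nat \<Rightarrow> bool) topology) p r. homeomorphic_maps X Z p r"
proof -
  obtain p :: "'a \<Rightarrow> nat \<Rightarrow> bool" where p: "inj_on p (topspace X)"
    using compact_metrizable_inj_into_nat_bool[OF assms] by blast
  define r where "r = inv_into (topspace X) p"
  define Z where "Z = pullback_topology (p ` topspace X) r X"
  have rp: "r (p x) = x" if "x \<in> topspace X" for x
    using p that by (simp add: r_def)
  have "continuous_map X Z p"
    unfolding Z_def by (rule continuous_map_pullback') (auto intro: continuous_map_eq[OF continuous_map_id] simp: rp)
  moreover have "continuous_map Z X r"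
    using continuous_map_pullback[OF continuous_map_id[of X], of "p ` topspace X" r] by (simp add: Z_def)
  moreover have "topspace Z = p ` topspace X"
    by (auto simp: Z_def topspace_pullback_topology rp)
  ultimately have "homeomorphic_maps X Z p r"
    by (auto simp: homeomorphic_maps_def rp)
  then show ?thesis by blast
qed

lemma cantor_set_homeomorphic_maps:
  assumes "homeomorphic_maps X Z p r" "cantor_set X"
  shows "cantor_set Z"
proof -
  have hp: "homeomorphic_map X Z p" and hr: "homeomorphic_map Z X r"
    using assms(1) homeomorphic_maps_map homeomorphic_maps_sym by blast+
  have hs: "X homeomorphic_space Z"
    using assms(1) homeomorphic_space_def by blast
  have X: "topspace X \<noteq> {}" "compact_space X" "metrizable_space X"
      "totally_disconnected_space X" "\<And>x. x \<in> topspace X \<Longrightarrow> \<not> openin X {x}"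
    using assms(2) by (auto simp: cantor_set_def)
  have pr: "p (r z) = z" "r z \<in> topspace X" if "z \<in> topspace Z" for z
    using assms(1) that by (auto simp: homeomorphic_maps_def continuous_map_def Pi_iff)
  have "totally_disconnected_space Z"
    unfolding totally_disconnected_space_def
  proof (intro allI impI)
    fix C assume C: "connectedin Z C"
    then have "connectedin X (r ` C)"
      using hr homeomorphic_imp_continuous_map connectedin_continuous_map_image by blast
    then obtain x where "r ` C \<subseteq> {x}"
      using X(4) unfolding totally_disconnected_space_def by blast
    then have "C \<subseteq> {p x}"
      using pr(1) connectedin_subset_topspace[OF C] by force
    then show "\<exists>x. C \<subseteq> {x}" by blast
  qed
  moreover have "\<not> openin Z {z}" if z: "z \<in> topspace Z" for z
    using X(5)[OF pr(2)[OF z]] homeomorphic_map_openness[OF hr, of "{z}"] z by simp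
  ultimately show ?thesis
    using X homeomorphic_compact_space[OF hs] homeomorphic_metrizable_space[OF hs]
      homeomorphic_empty_space[OF hs] by (simp add: cantor_set_def)
qed

section \<open>Integer systems and their automorphisms\<close>

lemma (in group_action) action_in: "\<lbrakk>g \<in> carrier G; x \<in> E\<rbrakk> \<Longrightarrow> \<phi> g x \<in> E"
  using element_image by blast

lemma (in cantor_system) continuous_map_action:
  assumes "g \<in> carrier G"
  shows "continuous_map X X (T g)"
proof -
  have "continuous_map X (prod_topology (discrete_topology (carrier G)) X) (\<lambda>y. (g, y))"
    using assms by (intro continuous_map_pairedI) auto
  from continuous_map_compose[OF this continuous_action] show ?thesis
    by (simp add: o_def)
qed

text \<open>
  Each \<open>\<sigma> n\<close> is a bijection because \<open>\<sigma> (-n)\<close> is its inverse. As the integers are discrete, joint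
  continuity of the action amounts to continuity of every \<open>\<sigma> n\<close>.
\<close>

lemma minimal_integer_systemI:
  assumes cantor: "cantor_set Y"
    and cont: "\<And>n. continuous_map Y Y (\<sigma> n)"
    and zero: "\<And>y. y \<in> topspace Y \<Longrightarrow> \<sigma> 0 y = y"
    and add: "\<And>m n y. y \<in> topspace Y \<Longrightarrow> \<sigma> (m + n) y = \<sigma> m (\<sigma> n y)"
    and dense: "\<And>y. y \<in> topspace Y \<Longrightarrow> Y closure_of (range (\<lambda>n. \<sigma> n y)) = topspace Y"
  shows "minimal_cantor_system integer_group Y (\<lambda>n. restrict (\<sigma> n) (topspace Y))"
proof -
  let ?E = "topspace Y" and ?S = "\<lambda>n. restrict (\<sigma> n) (topspace Y)"
  have in_E: "\<sigma> n y \<in> ?E" if "y \<in> ?E" for n y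
    using cont that by (auto simp: continuous_map_def Pi_iff)
  have inverse: "\<sigma> m (\<sigma> n y) = y" if "y \<in> ?E" "m + n = 0" for m n y
    using add[OF that(1), of m n] zero that by simp
  have Bij: "?S n \<in> Bij ?E" for n
  proof -
    have "bij_betw (?S n) ?E ?E"
      by (rule bij_betw_byWitness[of _ "?S (-n)"]) (auto simp: in_E inverse)
    then show ?thesis by (simp add: Bij_def)
  qed
  have hom: "?S \<in> hom integer_group (BijGroup ?E)"
    using Bij by (intro homI) (auto simp: BijGroup_def compose_def in_E add fun_eq_iff)
  have "group_action integer_group ?E ?S"
    by (simp add: group_action_def group_hom_def group_hom_axioms_def hom group_BijGroup)
  moreover have "continuous_map (prod_topology (discrete_topology (carrier integer_group)) Y) Y (\<lambda>(g, x). ?S g x)"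
    unfolding continuous_map_def
  proof (intro conjI allI impI)
    show "(\<lambda>(g, x). ?S g x) \<in> topspace (prod_topology (discrete_topology (carrier integer_group)) Y) \<rightarrow> ?E"
      by (auto simp: in_E)
    fix U assume U: "openin Y U"
    have "{x \<in> topspace (prod_topology (discrete_topology (carrier integer_group)) Y).
        (case x of (g, x) \<Rightarrow> ?S g x) \<in> U} = (\<Union>n. {n} \<times> {y \<in> ?E. \<sigma> n y \<in> U})"
      by auto
    moreover have "openin (prod_topology (discrete_topology (carrier integer_group)) Y) \<dots>"
      using cont U by (intro openin_Union) (auto simp: openin_prod_Times_iff continuous_map_def)
    ultimately show "openin (prod_topology (discrete_topology (carrier integer_group)) Y)
        {x \<in> topspace (prod_topology (discrete_topology (carrier integer_group)) Y).
          (case x of (g, x) \<Rightarrow> ?S g x) \<in> U}"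
      by simp
  qed
  moreover have "Y closure_of orbit integer_group ?S y = ?E" if "y \<in> ?E" for y
  proof -
    have "orbit integer_group ?S y = range (\<lambda>n. \<sigma> n y)"
      using that by (auto simp: orbit_def)
    then show ?thesis using dense[OF that] by simp
  qed
  ultimately show ?thesis
    using cantor
    by (simp add: minimal_cantor_system_def cantor_system_def cantor_system_axioms_def
        minimal_cantor_system_axioms_def)
qed

text \<open>
  Continuity of the maps \<open>\<Phi> h\<close> is enough to make them homeomorphisms: the inverse of \<open>\<Phi> h\<close>
  is the image under \<open>\<Phi>\<close> of the inverse of \<open>h\<close>.
\<close>

lemma Aut_group_embedsI:
  assumes X: "cantor_system G X T" and Y: "cantor_system K Y S"
    and cont: "\<And>h. h \<in> automorphisms G X T \<Longrightarrow> continuous_map Y Y (\<Phi> h)"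
    and comm: "\<And>h k y. \<lbrakk>h \<in> automorphisms G X T; k \<in> carrier K; y \<in> topspace Y\<rbrakk>
      \<Longrightarrow> \<Phi> h (S k y) = S k (\<Phi> h y)"
    and one: "\<And>y. y \<in> topspace Y \<Longrightarrow> \<Phi> (restrict id (topspace X)) y = y"
    and mult: "\<And>h h' y. \<lbrakk>h \<in> automorphisms G X T; h' \<in> automorphisms G X T; y \<in> topspace Y\<rbrakk>
      \<Longrightarrow> \<Phi> (compose (topspace X) h h') y = \<Phi> h (\<Phi> h' y)"
    and faithful: "\<And>h h'. \<lbrakk>h \<in> automorphisms G X T; h' \<in> automorphisms G X T;
      \<And>y. y \<in> topspace Y \<Longrightarrow> \<Phi> h y = \<Phi> h' y\<rbrakk> \<Longrightarrow> h = h'"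
  shows "\<exists>H. subgroup H (Aut_group K Y S) \<and> Aut_group G X T \<cong> (Aut_group K Y S)\<lparr>carrier := H\<rparr>"
proof -
  let ?A = "automorphisms G X T" and ?E = "topspace Y" and ?R = "\<lambda>h. restrict (\<Phi> h) (topspace Y)"
  interpret A: group "Aut_group G X T"
    by (rule cantor_system.group_Aut_group[OF X])
  interpret B: group "Aut_group K Y S"
    by (rule cantor_system.group_Aut_group[OF Y])
  have carrier: "carrier (Aut_group G X T) = ?A" "carrier (Aut_group K Y S) = automorphisms K Y S"
    by (simp_all add: Aut_group_def)
  have multA: "h \<otimes>\<^bsub>Aut_group G X T\<^esub> h' = compose (topspace X) h h'" if "h \<in> ?A" "h' \<in> ?A" for h h'
    using that automorphisms_subset_Bij[of G X T] by (auto simp: Aut_group_def BijGroup_def)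
  have multB: "h \<otimes>\<^bsub>Aut_group K Y S\<^esub> h' = compose ?E h h'"
    if "h \<in> automorphisms K Y S" "h' \<in> automorphisms K Y S" for h h'
    using that automorphisms_subset_Bij[of K Y S] by (auto simp: Aut_group_def BijGroup_def)
  have oneA: "\<one>\<^bsub>Aut_group G X T\<^esub> = restrict id (topspace X)"
    by (simp add: Aut_group_def BijGroup_def id_def)
  have in_E: "\<Phi> h y \<in> ?E" if "h \<in> ?A" "y \<in> ?E" for h y
    using cont that by (auto simp: continuous_map_def Pi_iff)
  have S_in: "S k y \<in> ?E" if "k \<in> carrier K" "y \<in> ?E" for k y
    using group_action.element_image[OF cantor_system.axioms(1)[OF Y]] that by blast
  have R: "?R h \<in> automorphisms K Y S" if h: "h \<in> ?A" for h
  proof -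
    define h' where "h' = inv\<^bsub>Aut_group G X T\<^esub> h"
    have h': "h' \<in> ?A"
      using A.inv_closed h by (simp add: h'_def carrier)
    have "compose (topspace X) h h' = restrict id (topspace X)" "compose (topspace X) h' h = restrict id (topspace X)"
      using A.r_inv[of h] A.l_inv[of h] h h' by (simp_all add: carrier multA oneA flip: h'_def)
    then have "\<Phi> h (\<Phi> h' y) = y" "\<Phi> h' (\<Phi> h y) = y" if "y \<in> ?E" for y
      using mult[OF h h' that] mult[OF h' h that] one[OF that] by simp_all
    then have "homeomorphic_maps Y Y (\<Phi> h) (\<Phi> h')"
      using cont[OF h] cont[OF h'] by (simp add: homeomorphic_maps_def)
    then have "homeomorphic_map Y Y (?R h)"
      using homeomorphic_map_eq[of Y Y "\<Phi> h" "?R h"] by (simp add: homeomorphic_maps_map)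
    then show ?thesis
      using h by (auto simp: automorphisms_def comm S_in)
  qed
  interpret hom: group_hom "Aut_group G X T" "Aut_group K Y S" ?R
  proof
    show "?R \<in> hom (Aut_group G X T) (Aut_group K Y S)"
    proof (rule homI)
      fix h h' assume "h \<in> carrier (Aut_group G X T)" "h' \<in> carrier (Aut_group G X T)"
      then have hh: "h \<in> ?A" "h' \<in> ?A"
        by (simp_all add: carrier)
      have "?R (compose (topspace X) h h') y = compose ?E (?R h) (?R h') y" for y
        using mult[OF hh] in_E[OF hh(2)] by (cases "y \<in> ?E") (simp_all add: compose_eq, simp add: compose_def)
      then show "?R (h \<otimes>\<^bsub>Aut_group G X T\<^esub> h') = ?R h \<otimes>\<^bsub>Aut_group K Y S\<^esub> ?R h'"
        using multA[OF hh] multB[OF R[OF hh(1)] R[OF hh(2)]] by auto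
    qed (simp add: carrier R)
  qed
  let ?H = "?R ` ?A"
  have "inj_on ?R ?A"
  proof (rule inj_onI)
    fix h h' assume hh: "h \<in> ?A" "h' \<in> ?A" and eq: "?R h = ?R h'"
    show "h = h'"
    proof (rule faithful[OF hh])
      show "\<Phi> h y = \<Phi> h' y" if "y \<in> ?E" for y
        using fun_cong[OF eq, of y] that by simp
    qed
  qed
  then have "?R \<in> iso (Aut_group G X T) ((Aut_group K Y S)\<lparr>carrier := ?H\<rparr>)"
    using hom.homh by (auto simp: iso_def hom_def bij_betw_def carrier)
  moreover have "subgroup ?H (Aut_group K Y S)"
    using hom.img_is_subgroup by (simp add: carrier)
  ultimately show ?thesis
    unfolding is_iso_def by blast
qed

lemma minimal_integer_system_on_nat_bool:
  assumes "minimal_cantor_system integer_group Y S"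
  shows "\<exists>(Z :: (nat \<Rightarrow> bool) topology) p r. homeomorphic_maps Y Z p r \<and>
    minimal_cantor_system integer_group Z (\<lambda>n. restrict (p \<circ> S n \<circ> r) (topspace Z))"
proof -
  interpret minimal_cantor_system integer_group Y S by fact
  have "compact_space Y" "metrizable_space Y"
    using cantor_set by (auto simp: cantor_set_def)
  then obtain Z :: "(nat \<Rightarrow> bool) topology" and p r where hm: "homeomorphic_maps Y Z p r"
    using homeomorphic_copy_on_nat_bool by blast
  have hp: "homeomorphic_map Y Z p"
    using hm homeomorphic_maps_map by blast
  have pr: "p (r z) = z" "r z \<in> topspace Y" if "z \<in> topspace Z" for z
    using hm that by (auto simp: homeomorphic_maps_def continuous_map_def Pi_iff)
  have rp: "r (p y) = y" if "y \<in> topspace Y" for y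
    using hm that by (auto simp: homeomorphic_maps_def)
  have S_in: "S n y \<in> topspace Y" if "y \<in> topspace Y" for n y
    using element_image that by simp
  have "minimal_cantor_system integer_group Z (\<lambda>n. restrict (p \<circ> S n \<circ> r) (topspace Z))"
  proof (rule minimal_integer_systemI)
    show "cantor_set Z"
      using hm cantor_set by (rule cantor_set_homeomorphic_maps)
    show "continuous_map Z Z (p \<circ> S n \<circ> r)" for n
      using hm continuous_map_action unfolding homeomorphic_maps_def
      by (metis UNIV_I carrier_integer_group continuous_map_compose)
    fix z assume z: "z \<in> topspace Z"
    show "(p \<circ> S 0 \<circ> r) z = z"
      using id_eq_one pr z by (simp add: fun_eq_iff) (metis restrict_apply')
    show "(p \<circ> S (m + n) \<circ> r) z = (p \<circ> S m \<circ> r) ((p \<circ> S n \<circ> r) z)" for m n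
      using composition_rule[of "r z" m n] pr z S_in rp by simp
    have "range (\<lambda>n. S n (r z)) \<subseteq> topspace Y"
      using S_in pr(2)[OF z] by blast
    then have "Z closure_of (p ` range (\<lambda>n. S n (r z))) = p ` (Y closure_of (range (\<lambda>n. S n (r z))))"
      by (rule homeomorphic_map_closure_of[OF hp])
    moreover have "Y closure_of (range (\<lambda>n. S n (r z))) = topspace Y"
      using minimal[OF pr(2)[OF z]] by (simp add: orbit_def full_SetCompr_eq)
    ultimately show "Z closure_of (range (\<lambda>n. (p \<circ> S n \<circ> r) z)) = topspace Z"
      using homeomorphic_imp_surjective_map[OF hp] by (simp add: image_image)
  qed
  with hm show ?thesis by blast
qed

section \<open>The path space of a minimal system\<close>

definition translate :: "int \<Rightarrow> (int \<Rightarrow> 'a) \<Rightarrow> int \<Rightarrow> 'a"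
  where "translate n w = (\<lambda>i. w (i + n))"

abbreviation sequences :: "'a topology \<Rightarrow> (int \<Rightarrow> 'a) topology"
  where "sequences X \<equiv> product_topology (\<lambda>_. X) UNIV"

lemma topspace_sequences: "w \<in> topspace (sequences X) \<longleftrightarrow> (\<forall>i. w i \<in> topspace X)"
  by (auto simp: PiE_iff)

lemma continuous_map_coordinate: "continuous_map (sequences X) X (\<lambda>w. w i)"
  using continuous_map_product_projection[of i UNIV "\<lambda>_. X"] by simp

lemma continuous_map_translate: "continuous_map (sequences X) (sequences X) (translate n)"
  by (simp add: translate_def continuous_map_componentwise_UNIV continuous_map_coordinate)

sublocale minimal_cantor_system \<subseteq> group G
  using group_hom by (rule group_hom.axioms(1))

context minimal_cantor_system
begin

text \<open>
  Decoding pairs makes every element occur infinitely often.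
\<close>

definition enumeration :: "nat \<Rightarrow> 'a"
  where "enumeration n = from_nat_into (carrier G) (fst (prod_decode n))"

definition visit :: "int \<Rightarrow> 'a"
  where "visit = digit_product enumeration"

definition path :: "int \<Rightarrow> 'c \<Rightarrow> int \<Rightarrow> 'c"
  where "path k x = (\<lambda>i. T (visit (k + i)) x)"

definition paths :: "(int \<Rightarrow> 'c) set"
  where "paths = {path k x | k x. x \<in> topspace X}"

definition path_space :: "(int \<Rightarrow> 'c) topology"
  where "path_space = subtopology (sequences X) (sequences X closure_of paths)"

lemma range_enumeration: "range enumeration \<subseteq> carrier G"
  using from_nat_into[of "carrier G"] by (auto simp: enumeration_def)

lemma enumeration_recurrent:
  assumes "g \<in> carrier G"
  obtains j where "n \<le> j" "enumeration j = g"
proof -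
  obtain i where "from_nat_into (carrier G) i = g"
    using from_nat_into_surj[OF countable_group assms] by blast
  then have "enumeration (prod_encode (i, n)) = g"
    by (simp add: enumeration_def)
  then show thesis
    using that le_prod_encode_2 by blast
qed

lemma visit_closed [simp]: "visit k \<in> carrier G"
  by (simp add: visit_def range_enumeration)

lemma path_in: "x \<in> topspace X \<Longrightarrow> path k x \<in> topspace (sequences X)"
  by (simp add: path_def topspace_sequences action_in del: topspace_product_topology)

lemma path_0_0: "x \<in> topspace X \<Longrightarrow> path 0 x 0 = x"
  using id_eq_one by (simp add: path_def visit_def) (metis restrict_apply')

lemma translate_path: "translate n (path k x) = path (k + n) x"
  by (simp add: translate_def path_def add_ac)

lemma continuous_map_path: "continuous_map X (sequences X) (path k)"
  by (simp add: path_def continuous_map_componentwise_UNIV continuous_map_action)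

lemma inj_on_path: "inj_on (path k) (topspace X)"
proof (rule inj_onI)
  fix x y assume "x \<in> topspace X" "y \<in> topspace X" "path k x = path k y"
  then show "x = y"
    using inj_prop[OF visit_closed[of k]] by (auto simp: path_def inj_on_def dest: fun_cong[of _ _ 0])
qed

text \<open>
  By minimality every orbit meets \<open>V\<close>, so the preimages of \<open>V\<close> under the action form an open cover
  of the compact space \<open>X\<close>.
\<close>

lemma finitely_many_translates_meet:
  assumes V: "openin X V" "V \<noteq> {}"
  obtains F where "finite F" "F \<subseteq> carrier G" "\<And>x. x \<in> topspace X \<Longrightarrow> \<exists>g\<in>F. T g x \<in> V"
proof -
  define P where "P g = {x \<in> topspace X. T g x \<in> V}" for g
  have "openin X (P g)" if "g \<in> carrier G" for g
    using continuous_map_action[OF that] V(1) by (simp add: continuous_map_def P_def)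
  moreover have "topspace X \<subseteq> \<Union> (P ` carrier G)"
  proof
    fix x assume x: "x \<in> topspace X"
    obtain v where v: "v \<in> V" using V(2) by blast
    then have "v \<in> X closure_of (orbit G T x)"
      using minimal[OF x] openin_subset[OF V(1)] by blast
    then obtain g where "g \<in> carrier G" "T g x \<in> V"
      using V(1) v unfolding in_closure_of orbit_def by blast
    then show "x \<in> \<Union> (P ` carrier G)"
      using x by (auto simp: P_def)
  qed
  moreover have "compactin X (topspace X)"
    using cantor_set by (simp add: cantor_set_def compact_space_def)
  ultimately obtain \<F> where \<F>: "finite \<F>" "\<F> \<subseteq> P ` carrier G" "topspace X \<subseteq> \<Union> \<F>"
    using compactinD[of X "topspace X" "P ` carrier G"] by blast
  obtain F where F: "F \<subseteq> carrier G" "finite F" "\<F> = P ` F"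
    using finite_subset_image[OF \<F>(1,2)] by blast
  show thesis
  proof (rule that[OF F(2,1)])
    fix x assume "x \<in> topspace X"
    with \<F>(3) F(3) show "\<exists>g\<in>F. T g x \<in> V"
      by (auto simp: P_def)
  qed
qed

text \<open>
  The bound \<open>L\<close> depends neither on the path nor on the starting time \<open>a\<close>. This uniformity makes
  the return property survive in the closure of the set of paths.
\<close>

lemma path_returns:
  assumes x': "x' \<in> topspace X" and W: "openin (sequences X) W" "path 0 x' \<in> W"
  obtains L where "\<And>a x. x \<in> topspace X \<Longrightarrow> \<exists>s\<in>{0..L}. path (a + s) x \<in> W"
proof -
  obtain U where "finite {i. U i \<noteq> topspace X}" and U: "\<And>i. openin X (U i)" "path 0 x' \<in> PiE UNIV U" "PiE UNIV U \<subseteq> W"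
    using W unfolding openin_product_topology_alt by auto
  \<comment> \<open>Only the times in \<open>J\<close> restrict a sequence in the basic neighbourhood given by \<open>U\<close>.\<close>
  define J where "J = {i. U i \<noteq> topspace X}"
  have J: "finite J"
    using \<open>finite {i. U i \<noteq> topspace X}\<close> by (simp add: J_def)
  then obtain n where n: "\<And>i. i \<in> J \<Longrightarrow> nat \<bar>i\<bar> \<le> n"
    using finite_nat_set_iff_bounded_le[of "(\<lambda>i. nat \<bar>i\<bar>) ` J"] by auto
  \<comment> \<open>A point belongs to \<open>V\<close> when its path agrees with \<open>U\<close> on the whole window \<open>J\<close>.\<close>
  define V where "V = (\<Inter>i\<in>J. {x \<in> topspace X. T (visit i) x \<in> U i}) \<inter> topspace X"
  have "openin X V"
    unfolding V_def using J continuous_map_action U(1)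
    by (intro openin_INT) (auto simp: continuous_map_def)
  moreover have "x' \<in> V"
    using x' U(2) by (auto simp: V_def path_def)
  ultimately obtain F where F: "finite F" "F \<subseteq> carrier G" "\<And>x. x \<in> topspace X \<Longrightarrow> \<exists>g\<in>F. T g x \<in> V"
    using finitely_many_translates_meet by blast
  have "\<exists>j\<ge>n. enumeration j = g" if "g \<in> F" for g
  proof -
    have "g \<in> carrier G"
      using that F(2) by blast
    then show ?thesis
      by (rule enumeration_recurrent[of g n]) blast
  qed
  then obtain time where time: "\<And>g. g \<in> F \<Longrightarrow> n \<le> time g \<and> enumeration (time g) = g"
    by metis
  obtain m where m: "\<And>g. g \<in> F \<Longrightarrow> time g < m"
    using F(1) finite_nat_set_iff_bounded[of "time ` F"] by auto
  have "\<exists>s\<in>{0..2 * 4 ^ m}. path (a + s) x \<in> W" if x: "x \<in> topspace X" for a x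
  proof -
    \<comment> \<open>\<open>k\<close> is \<open>a / 4\<^sup>m\<close> rounded up: \<open>4\<^sup>m k\<close> is the first multiple of \<open>4\<^sup>m\<close> from time \<open>a\<close> on.\<close>
    define k where "k = - ((- a) div 4 ^ m)"
    have "4 ^ m * k = a + (- a) mod 4 ^ m"
      unfolding k_def mult_minus_right minus_mod_eq_mult_div[symmetric] by simp
    then have k: "a \<le> 4 ^ m * k" "4 ^ m * k < a + 4 ^ m"
      by simp_all
    define x1 where "x1 = T (visit (4 ^ m * k)) x"
    have x1: "x1 \<in> topspace X"
      using x by (simp add: x1_def action_in)
    then obtain g where g: "g \<in> F" "T g x1 \<in> V"
      using F(3) by blast
    define j where "j = time g"
    have j: "n \<le> j" "j < m" "enumeration j = g"
      using time[OF g(1)] m[OF g(1)] by (simp_all add: j_def)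
    define s where "s = 4 ^ m * k + 2 * 4 ^ j - a"
    have "(4::int) ^ Suc j \<le> 4 ^ m"
      using j(2) by (intro power_increasing) auto
    then have "s \<in> {0..2 * 4 ^ m}"
      using k zero_le_power[of "4::int" j] unfolding s_def atLeastAtMost_iff power_Suc by linarith
    moreover have "path (a + s) x t \<in> U t" for t
    proof (cases "t \<in> J")
      case True
      have "\<bar>t\<bar> \<le> int n"
        using n[OF True] by linarith
      moreover have "int n < 4 ^ n"
        using of_nat_less_two_power[of n, where 'a = int] power_mono[of "2::int" 4 n] by linarith
      moreover have "(4::int) ^ n \<le> 4 ^ j"
        using j(1) by (intro power_increasing) auto
      ultimately have "- (4 ^ j) \<le> t" "t < 4 ^ j"
        by linarith+
      then have "visit (a + s + t) = visit t \<otimes> (g \<otimes> visit (4 ^ m * k))"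
        using digit_product_window[OF range_enumeration j(2), of t k] j(3) by (simp add: visit_def s_def)
      then have "path (a + s) x t = T (visit t) (T g x1)"
        using x x1 g(1) F(2) by (simp add: path_def composition_rule x1_def subset_iff)
      then show ?thesis
        using g(2) True by (simp add: V_def)
    next
      case False
      then show ?thesis
        using path_in[OF x] by (simp add: J_def topspace_sequences del: topspace_product_topology)
    qed
    then have "path (a + s) x \<in> W"
      using U(3) by auto
    ultimately show ?thesis
      by blast
  qed
  then show thesis
    by (rule that)
qed

lemma paths_subset: "paths \<subseteq> topspace (sequences X)"
  using path_in by (auto simp: paths_def simp del: topspace_product_topology)

lemma topspace_path_space: "topspace path_space = sequences X closure_of paths"
  using closure_of_subset_topspace[of "sequences X" paths]
  by (auto simp: path_space_def simp del: topspace_product_topology)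

lemma path_in_path_space: "x \<in> topspace X \<Longrightarrow> path k x \<in> topspace path_space"
  using closure_of_subset[OF paths_subset] by (auto simp: topspace_path_space paths_def)

lemma continuous_map_path_spaceI:
  assumes "continuous_map (sequences X) (sequences X) f" "f ` paths \<subseteq> paths"
  shows "continuous_map path_space path_space f"
proof -
  have "f ` (sequences X closure_of paths) \<subseteq> sequences X closure_of paths"
    using continuous_map_image_closure_subset[OF assms(1), of paths] closure_of_mono[OF assms(2)]
    by blast
  then show ?thesis
    unfolding path_space_def
    by (intro continuous_map_into_subtopology continuous_map_from_subtopology assms(1)) auto
qed

lemma regular_space_sequences: "regular_space (sequences X)"
  using cantor_set
  by (simp add: cantor_set_def regular_space_product_topology metrizable_imp_regular_space)

text \<open>
  Regularity provides a closed set between \<open>path 0 x'\<close> and \<open>W\<close>. The sequences that enter it within time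
  \<open>L\<close> form a closed set, which contains all paths and hence all of the path space.
\<close>

lemma translate_returns:
  assumes y: "y \<in> topspace path_space" and x': "x' \<in> topspace X"
    and W: "openin (sequences X) W" "path 0 x' \<in> W"
  shows "\<exists>s. translate s y \<in> W"
proof -
  let ?S = "sequences X"
  obtain U C where U: "openin ?S U" "path 0 x' \<in> U" and C: "closedin ?S C" "U \<subseteq> C" "C \<subseteq> W"
    using regular_space_sequences W unfolding neighbourhood_base_of_closedin[symmetric] neighbourhood_base_of
    by metis
  obtain L where L: "\<And>a x. x \<in> topspace X \<Longrightarrow> \<exists>s\<in>{0..L}. path (a + s) x \<in> U"
    using path_returns[OF x' U] by blast
  define K where "K = (\<Union>s\<in>{0..L}. {w \<in> topspace ?S. translate s w \<in> C})"
  have "closedin ?S K"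
    unfolding K_def using C(1) continuous_map_translate
    by (intro closedin_Union) (auto intro!: closedin_continuous_map_preimage simp del: topspace_product_topology)
  moreover have "paths \<subseteq> K"
  proof
    fix w assume "w \<in> paths"
    then obtain a x where w: "w = path a x" "x \<in> topspace X"
      by (auto simp: paths_def)
    then obtain s where "s \<in> {0..L}" "translate s w \<in> U"
      using L[OF w(2), of a] by (auto simp: translate_path)
    then show "w \<in> K"
      using C(2) path_in[OF w(2)] w(1) unfolding K_def by blast
  qed
  ultimately have "y \<in> K"
    using closure_of_minimal y topspace_path_space by blast
  then show ?thesis
    using C(3) by (auto simp: K_def)
qed

text \<open>
  The closure of an orbit contains \<open>path 0 x\<close> for every \<open>x\<close>; it is invariant under translation,
  so it contains all paths.
\<close>

lemma dense_translates:
  assumes y: "y \<in> topspace path_space"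
  shows "path_space closure_of (range (\<lambda>n. translate n y)) = topspace path_space"
proof -
  let ?S = "sequences X" and ?O = "range (\<lambda>n. translate n y)"
  have "paths \<subseteq> ?S closure_of ?O"
  proof
    fix w assume "w \<in> paths"
    then obtain k x where w: "w = translate k (path 0 x)" "x \<in> topspace X"
      by (auto simp: paths_def translate_path)
    have "path 0 x \<in> ?S closure_of ?O"
      using translate_returns[OF y w(2)] path_in[OF w(2)] unfolding in_closure_of by blast
    then have "w \<in> translate k ` (?S closure_of ?O)"
      using w(1) by blast
    also have "\<dots> \<subseteq> ?S closure_of (translate k ` ?O)"
      by (rule continuous_map_image_closure_subset[OF continuous_map_translate])
    also have "\<dots> \<subseteq> ?S closure_of ?O"
      by (rule closure_of_mono) (auto simp: translate_def add.assoc)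
    finally show "w \<in> ?S closure_of ?O" .
  qed
  then have "?S closure_of paths \<subseteq> ?S closure_of ?O"
    by (simp add: closure_of_minimal)
  moreover have "?O \<subseteq> topspace path_space"
    using continuous_map_path_spaceI[OF continuous_map_translate] y
    by (fastforce simp: continuous_map_def paths_def translate_path)
  ultimately show ?thesis
    unfolding topspace_path_space by (simp add: path_space_def closure_of_subtopology Int_absorb1 Int_absorb2)
qed

text \<open>
  All properties but the last are inherited from \<open>X\<close>. An isolated point would be a
  path \<open>path k x\<close>, because paths are dense, and then \<open>x\<close> would be isolated in \<open>X\<close>, because \<open>path k\<close> is
  continuous and injective.
\<close>

lemma cantor_set_path_space: "cantor_set path_space"
proof -
  let ?S = "sequences X"
  have X: "topspace X \<noteq> {}" "compact_space X" "metrizable_space X"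
      "totally_disconnected_space X" "\<And>x. x \<in> topspace X \<Longrightarrow> \<not> openin X {x}"
    using cantor_set by (auto simp: cantor_set_def)
  have "topspace path_space \<noteq> {}"
    using X(1) path_in_path_space by blast
  moreover have "compact_space path_space"
    unfolding path_space_def using X(2)
    by (intro compact_space_subtopology closedin_compact_space) (simp_all add: compact_space_product_topology)
  moreover have "metrizable_space path_space"
    unfolding path_space_def using X(3)
    by (intro metrizable_space_subtopology) (simp add: metrizable_space_product_topology)
  moreover have "totally_disconnected_space path_space"
    unfolding totally_disconnected_space_def
  proof (intro allI impI)
    fix C assume "connectedin path_space C"
    then have "connectedin ?S C"
      by (simp add: path_space_def connectedin_subtopology)
    then have "connectedin X ((\<lambda>w. w i) ` C)" for i
      using continuous_map_coordinate connectedin_continuous_map_image by blast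
    then have "\<exists>x. (\<lambda>w. w i) ` C \<subseteq> {x}" for i
      using X(4) unfolding totally_disconnected_space_def by blast
    then obtain c where "\<And>i. (\<lambda>w. w i) ` C \<subseteq> {c i}"
      by metis
    then have "C \<subseteq> {c}"
      by (auto simp: fun_eq_iff)
    then show "\<exists>x. C \<subseteq> {x}"
      by blast
  qed
  moreover have "\<not> openin path_space {y}" if y: "y \<in> topspace path_space" for y
  proof
    assume "openin path_space {y}"
    then obtain W where W: "openin ?S W" "{y} = W \<inter> topspace path_space"
      unfolding topspace_path_space unfolding path_space_def openin_subtopology by blast
    then obtain w where "w \<in> paths" "w \<in> W"
      using y unfolding topspace_path_space in_closure_of by blast
    then obtain k x where x: "x \<in> topspace X" "path k x \<in> W"
      by (auto simp: paths_def)
    have "{z \<in> topspace X. path k z \<in> W} = {x}"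
    proof -
      have "z = x" if "z \<in> topspace X" "path k z \<in> W" for z
        using that x W(2) path_in_path_space inj_on_path by (metis IntI inj_onD singletonD)
      then show ?thesis
        using x by blast
    qed
    then have "openin X {x}"
      using openin_continuous_map_preimage[OF continuous_map_path W(1), of k] by simp
    then show False
      using X(5) x(1) by blast
  qed
  ultimately show ?thesis
    by (simp add: cantor_set_def)
qed

lemma minimal_path_space:
  "minimal_cantor_system integer_group path_space (\<lambda>n. restrict (translate n) (topspace path_space))"
proof (rule minimal_integer_systemI[OF cantor_set_path_space])
  show "continuous_map path_space path_space (translate n)" for n
    by (rule continuous_map_path_spaceI[OF continuous_map_translate]) (fastforce simp: paths_def translate_path)
  show "translate 0 y = y" for y :: "int \<Rightarrow> 'c"
    by (simp add: translate_def)
  show "translate (m + n) y = translate m (translate n y)" for m n and y :: "int \<Rightarrow> 'c"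
    by (simp add: translate_def add.assoc)
  show "path_space closure_of (range (\<lambda>n. translate n y)) = topspace path_space"
    if "y \<in> topspace path_space" for y
    using that by (rule dense_translates)
qed

text \<open>
  An automorphism commutes with the action, so it sends \<open>path k x\<close> to \<open>path k (h x)\<close>; by
  continuity it then preserves the closure of the set of paths.
\<close>

lemma continuous_map_coordinatewise_automorphism:
  assumes h: "h \<in> automorphisms G X T"
  shows "continuous_map path_space path_space (\<lambda>w i. h (w i))"
proof (rule continuous_map_path_spaceI)
  have c: "continuous_map X X h"
    using h by (simp add: automorphisms_def homeomorphic_imp_continuous_map)
  show "continuous_map (sequences X) (sequences X) (\<lambda>w i. h (w i))"
    unfolding continuous_map_componentwise_UNIV
    using continuous_map_compose[OF continuous_map_coordinate c] by (simp add: o_def)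
  have "(\<lambda>i. h (path k x i)) = path k (h x)" if "x \<in> topspace X" for k x
    using h that by (auto simp: automorphisms_def path_def)
  moreover have "h x \<in> topspace X" if "x \<in> topspace X" for x
    using c that by (auto simp: continuous_map_def Pi_iff)
  ultimately show "(\<lambda>w i. h (w i)) ` paths \<subseteq> paths"
    by (fastforce simp: paths_def)
qed

end

section \<open>Embedding the automorphism group\<close>

theorem proposition5:
  fixes G :: "('g, 'm) monoid_scheme"
    and X :: "'a topology"
    and T :: "'g \<Rightarrow> 'a \<Rightarrow> 'a"
  assumes "aperiodic_cantor_system G X T"
    and "minimal_cantor_system G X T"
  shows "\<exists>(Y :: (nat \<Rightarrow> bool) topology) (S :: int \<Rightarrow> (nat \<Rightarrow> bool) \<Rightarrow> (nat \<Rightarrow> bool)) H.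
    minimal_cantor_system integer_group Y S \<and>
    subgroup H (Aut_group integer_group Y S) \<and>
    Aut_group G X T \<cong> (Aut_group integer_group Y S)\<lparr>carrier := H\<rparr>"
proof -
  interpret minimal_cantor_system G X T by fact
  obtain Y :: "(nat \<Rightarrow> bool) topology" and p r where
    pr: "homeomorphic_maps path_space Y p r" and
    min: "minimal_cantor_system integer_group Y
      (\<lambda>n. restrict (p \<circ> restrict (translate n) (topspace path_space) \<circ> r) (topspace Y))"
      (is "minimal_cantor_system _ _ ?S")
    using minimal_integer_system_on_nat_bool[OF minimal_path_space] by blast
  have r: "continuous_map Y path_space r" and p: "continuous_map path_space Y p"
    using pr by (simp_all add: homeomorphic_maps_def)
  have r_in: "r y \<in> topspace path_space" and pr_y: "p (r y) = y" if "y \<in> topspace Y" for y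
    using pr that by (auto simp: homeomorphic_maps_def continuous_map_def Pi_iff)
  have p_in: "p w \<in> topspace Y" and rp: "r (p w) = w" if "w \<in> topspace path_space" for w
    using pr that by (auto simp: homeomorphic_maps_def continuous_map_def Pi_iff)
  have in_X: "w i \<in> topspace X" if "w \<in> topspace path_space" for w i
    using that closure_of_subset_topspace[of "sequences X" paths]
    by (auto simp: topspace_path_space topspace_sequences simp del: topspace_product_topology)
  define \<Phi> where "\<Phi> h = p \<circ> (\<lambda>w i. h (w i)) \<circ> r" for h
  have h_in: "(\<lambda>i. h (w i)) \<in> topspace path_space"
    if "h \<in> automorphisms G X T" "w \<in> topspace path_space" for h w
    using continuous_map_coordinatewise_automorphism[OF that(1)] that(2)
    by (auto simp: continuous_map_def Pi_iff)
  have t_in: "translate n w \<in> topspace path_space" if "w \<in> topspace path_space" for n w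
    using group_action.action_in[OF cantor_system.axioms(1)[OF minimal_cantor_system.axioms(1)[OF minimal_path_space]], of n w] that
    by simp
  have "\<exists>H. subgroup H (Aut_group integer_group Y ?S) \<and>
      Aut_group G X T \<cong> (Aut_group integer_group Y ?S)\<lparr>carrier := H\<rparr>"
  proof (rule Aut_group_embedsI[OF _ minimal_cantor_system.axioms(1)[OF min]])
    show "cantor_system G X T"
      by (rule cantor_system_axioms)
    show "continuous_map Y Y (\<Phi> h)" if "h \<in> automorphisms G X T" for h
      unfolding \<Phi>_def
      using r p continuous_map_coordinatewise_automorphism[OF that] continuous_map_compose by metis
    show "\<Phi> h (?S n y) = ?S n (\<Phi> h y)" if "h \<in> automorphisms G X T" "y \<in> topspace Y" for h n y
      using that by (simp add: \<Phi>_def r_in rp p_in h_in t_in) (simp add: translate_def)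
    show "\<Phi> (restrict id (topspace X)) y = y" if "y \<in> topspace Y" for y
      using that by (simp add: \<Phi>_def r_in in_X pr_y)
    show "\<Phi> (compose (topspace X) h h') y = \<Phi> h (\<Phi> h' y)"
      if "h \<in> automorphisms G X T" "h' \<in> automorphisms G X T" "y \<in> topspace Y" for h h' y
      using that by (simp add: \<Phi>_def r_in in_X rp h_in compose_def)
    show "h = h'" if h: "h \<in> automorphisms G X T" "h' \<in> automorphisms G X T"
      and eq: "\<And>y. y \<in> topspace Y \<Longrightarrow> \<Phi> h y = \<Phi> h' y" for h h'
    proof (rule extensionalityI)
      show "h \<in> extensional (topspace X)" "h' \<in> extensional (topspace X)"
        using h by (simp_all add: automorphisms_def)
      fix x assume x: "x \<in> topspace X"
      let ?w = "path 0 x"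
      have w: "?w \<in> topspace path_space"
        using x by (rule path_in_path_space)
      have "p (\<lambda>i. h (?w i)) = p (\<lambda>i. h' (?w i))"
        using eq[OF p_in[OF w]] by (simp add: \<Phi>_def rp[OF w])
      then have "(\<lambda>i. h (?w i)) = (\<lambda>i. h' (?w i))"
        using rp[OF h_in[OF h(1) w]] rp[OF h_in[OF h(2) w]] by metis
      then show "h x = h' x"
        using path_0_0[OF x] by metis
    qed
  qed
  then show ?thesis
    using min by blast
qed

end
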